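(* Let $\Phi_h$ be a numerical scheme of order $p$, let $\Phi_h^{f_{app}(\cdot,h)}$ be its flow when applied to the vector field $f_{app}(\cdot,h)$, and consider the global error $$e_n := \left(\Phi_h^{f_{app}(\cdot,h)}\right)^n(y_0) - \left(\varphi_h^f\right)^n(y_0)$$ at times $t_n = nh$, $0\le n\le N$, where $h=T/N\in[h_-,h_+]$. Define the learning error $$\delta := \max_{(y,h)\in\Omega\times[h_-,h_+]} \frac{\left|\tilde f_h(y) - f_{app}(y,h)\right|}{h^p}.$$ Assume that: (i) there is a constant $C>0$ such that for any pair of smooth vector fields $f_1,f_2$ (with $C$ independent of $f_1$ and $f_2$), $$\forall\, 0\le h\le h_+,\quad \left\|\Phi_h^{f_1}-\Phi_h^{f_2}\right\|_{L^\infty(\Omega)} \le C h\,\|f_1-f_2\|_{L^\infty(\Omega)};$$ (ii) for any smooth vector field $g$ there exists a constant $L>0$ such that $$\forall\, 0\le h\le h_+,\ \forall (y_1,y_2)\in\Omega^2,\quad \left|\Phi_h^{g}(y_1)-\Phi_h^{g}(y_2)\right| \le (1+Lh)\,|y_1-y_2|.$$ Then there exists a constant $\tilde L>0$ such that, for every such $h=T/N\in[h_-,h_+]$, $$\max_{0\le n\le N} |e_n| \le \frac{C\,\delta\, h^p}{\tilde L}\left(e^{\tilde L T}-1\right),$$ where $C$ is the constant of (i).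
   Context: Consider the autonomous ODE $\dot y(t)=f(y(t))\in\mathbb{R}^d$, $t\in[0,T]$, $y(0)=y_0$, with $f:\mathbb{R}^d\to\mathbb{R}^d$ smooth; $\varphi_t^f$ denotes its exact flow and $|\cdot|$ a norm on $\mathbb{R}^d$. The time step is $h=T/N$ with $N\ge1$ an integer, and $0<h_-<h_+$ are fixed bounds on the step. $\Omega\subset\mathbb{R}^d$ is a compact set in which the solution is to be simulated: $y_0\in\Omega$, and the exact solution points $y(t_n)=\varphi^f_{nh}(y_0)$ and the numerical iterates $(\Phi_h^{f_{app}(\cdot,h)})^n(y_0)$, $0\le n\le N$, lie in $\Omega$. For a vector field $g$, $\Phi_h^{g}$ denotes the numerical flow (one-step map with step $h$) of a given one-step method applied to $g$. The method is of order $p$ in the sense that $\max_{0\le n\le N}|(\Phi_h^f)^n(y_0)-\varphi_{nh}^f(y_0)|\le c\,h^p$ for some constant $c>0$. The modified field $\tilde f_h$ is the smooth vector field, of the form $\tilde f_h(y)=f(y)+h^p\sum_{j=1}^{k-1}h^{j-1}f^{[j]}(y)+h^{k+p-1}R(y,h)$, for which the scheme reproduces the exact flow, i.e. $\Phi_h^{\tilde f_h}(y)=\varphi_h^f(y)$ along the exact solution (at the points $y=y(t_n)$), so that $(\Phi_h^{\tilde f_h})^n(y_0)=\varphi_{nh}^f(y_0)$; its existence is assumed. The learned field is $f_{app}(y,h)=f(y)+h^p\sum_{j=1}^{N_t-1}h^{j-1}f_j(y)+h^{N_t+p-1}R_a(y,h)$, where the $f_j$ and $R_a$ are multilayer perceptrons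 (compositions of affine maps and activation functions) with smooth activation functions, so that $f_{app}$ is smooth. *)

theory Defs
  imports "HOL-Analysis.Analysis"
begin

definition is_norm :: "('a::real_vector \<Rightarrow> real) \<Rightarrow> bool" where
  "is_norm nrm \<longleftrightarrow>
     (\<forall>x. nrm x = 0 \<longleftrightarrow> x = 0) \<and>
     (\<forall>a x. nrm (a *\<^sub>R x) = \<bar>a\<bar> * nrm x) \<and>
     (\<forall>x y. nrm (x + y) \<le> nrm x + nrm y)"

(* In finite dimension, continuity of all directional derivatives of order at most k
   is the usual notion of class C^k. *)
fun Ck :: "nat \<Rightarrow> ('a::euclidean_space \<Rightarrow> 'b::euclidean_space) \<Rightarrow> bool" where
  "Ck 0 g \<longleftrightarrow> continuous_on UNIV g"
| "Ck (Suc k) g \<longleftrightarrow>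
     (\<forall>x. g differentiable (at x)) \<and> (\<forall>v. Ck k (\<lambda>x. frechet_derivative g (at x) v))"

definition smooth :: "('a::euclidean_space \<Rightarrow> 'b::euclidean_space) \<Rightarrow> bool" where
  "smooth g \<longleftrightarrow> (\<forall>k. Ck k g)"

definition solves_ivp ::
    "('a::euclidean_space \<Rightarrow> 'a) \<Rightarrow> 'a \<Rightarrow> real \<Rightarrow> (real \<Rightarrow> 'a) \<Rightarrow> bool" where
  "solves_ivp g y0 T u \<longleftrightarrow>
     u 0 = y0 \<and> (\<forall>t\<in>{0..T}. (u has_vector_derivative g (u t)) (at t within {0..T}))"

(* Meaningful for t >= 0 whenever the solution through y exists on [0,t];
   it is then unique for smooth g. The flow is not assumed to be complete. *)
definition exact_flow :: "('a::euclidean_space \<Rightarrow> 'a) \<Rightarrow> real \<Rightarrow> 'a \<Rightarrow> 'a" where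
  "exact_flow g t y = (THE z. \<exists>u. solves_ivp g y t u \<and> u t = z)"

(* A one-step method: step size, vector field, point. *)
type_synonym 'a one_step_method = "real \<Rightarrow> ('a \<Rightarrow> 'a) \<Rightarrow> 'a \<Rightarrow> 'a"

(* Step sizes T/N with 0 < T/N <= hmax; there is no positive lower bound on the step here,
   since otherwise only finitely many N would occur and the condition would be void. *)
definition has_order ::
    "('a::euclidean_space \<Rightarrow> real) \<Rightarrow> 'a one_step_method \<Rightarrow> ('a \<Rightarrow> 'a) \<Rightarrow> 'a \<Rightarrow> real \<Rightarrow> real \<Rightarrow> nat \<Rightarrow> bool"
  where
  "has_order nrm \<Phi> f y0 T hmax p \<longleftrightarrow>
     (\<exists>c>0. \<forall>N\<ge>1. \<forall>h. h = T / real N \<longrightarrow> h \<le> hmax \<longrightarrow>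
        Max ((\<lambda>n. nrm ((\<Phi> h f ^^ n) y0 - exact_flow f (real n * h) y0)) ` {0..N}) \<le> c * h ^ p)"

definition Linf_norm :: "('a \<Rightarrow> real) \<Rightarrow> 'b set \<Rightarrow> ('b \<Rightarrow> 'a) \<Rightarrow> ennreal" where
  "Linf_norm nrm \<Omega> F = (SUP y\<in>\<Omega>. ennreal (nrm (F y)))"

(* f + h^p * (sum over 1 <= j <= K-1 of h^(j-1) * g_j) + h^(K+p-1) * R, for K >= 1 *)
definition perturbed_field ::
    "nat \<Rightarrow> nat \<Rightarrow> ('a::real_vector \<Rightarrow> 'a) \<Rightarrow> (nat \<Rightarrow> 'a \<Rightarrow> 'a) \<Rightarrow> ('a \<times> real \<Rightarrow> 'a) \<Rightarrow> real \<Rightarrow> 'a \<Rightarrow> 'a"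
  where
  "perturbed_field p K f g R h y =
     f y + h ^ p *\<^sub>R (\<Sum>j=1..K-1. h ^ (j - 1) *\<^sub>R g j y) + h ^ (K + p - 1) *\<^sub>R R (y, h)"

(* "mlp_layers H m": H maps an input x to a vector with coordinates H x i, i < m, where H is a
   composition of affine maps and coordinatewise smooth activation functions. The width m may
   change from layer to layer; coordinates H x i with i >= m are never read. *)
inductive mlp_layers :: "('a::euclidean_space \<Rightarrow> nat \<Rightarrow> real) \<Rightarrow> nat \<Rightarrow> bool" where
  input_affine: "mlp_layers (\<lambda>x i. w i \<bullet> x + b i) m"
| activation: "mlp_layers H m \<Longrightarrow> smooth \<sigma> \<Longrightarrow> mlp_layers (\<lambda>x i. \<sigma> (H x i)) m"
| hidden_affine: "mlp_layers H m \<Longrightarrow> mlp_layers (\<lambda>x i. (\<Sum>j<m. W i j * H x j) + b i) m'"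

definition smooth_mlp :: "('a::euclidean_space \<Rightarrow> 'b::euclidean_space) \<Rightarrow> bool" where
  "smooth_mlp F \<longleftrightarrow>
     (\<exists>H m v c. mlp_layers H m \<and> F = (\<lambda>x. (\<Sum>i<m. H x i *\<^sub>R v i) + c))"

definition is_max :: "real \<Rightarrow> real set \<Rightarrow> bool" where
  "is_max m S \<longleftrightarrow> m \<in> S \<and> (\<forall>s\<in>S. s \<le> m)"

end

theory Submission
  imports Defs
begin

text \<open>
  The proof is the classical argument that local errors accumulate geometrically. The modified
  field \<open>f_tilde h\<close> makes the scheme exact along the solution. With \<open>A = \<Phi> h (f_app h)\<close> and
  \<open>B = \<Phi> h (f_tilde h)\<close>, one step of the error therefore splits as
  \<open>A x\<^sub>n - B y\<^sub>n = (A x\<^sub>n - A y\<^sub>n) + (A y\<^sub>n - B y\<^sub>n)\<close>,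
  where \<open>x\<^sub>n\<close> is the numerical iterate and \<open>y\<^sub>n\<close> the exact value. Hypothesis (ii) bounds the first
  difference by \<open>(1 + L h) e\<^sub>n\<close>. Hypothesis (i), together with the definition of \<open>\<delta>\<close>, bounds the
  second one by \<open>C h \<delta> h\<^sup>p\<close>. A discrete Gronwall inequality (\<open>discrete_gronwall\<close>) then
  gives the estimate.

  Three points need an argument beyond this recursion. First, (i) and (ii) apply to smooth fields
  only, so the learned field has to be shown smooth: \<open>C\<^sup>k\<close> maps are closed under sums, bilinear
  products and composition, and every network is built from these (\<open>smooth_mlp_imp_smooth\<close>).
  Secondly, \<open>e\<^sub>n\<close> is measured against the iterated exact flow, while exactness of the scheme is known
  at the points \<open>exact_flow f (n h) y\<^sub>0\<close>. These agree by the semigroup property (\<open>exact_flow_iterate\<close>), which rests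
  on uniqueness for the initial value problem (\<open>solves_ivp_unique\<close>). Thirdly, the constant of (ii)
  depends on the field and so, through the learned field, on the step; but only finitely many
  steps \<open>T / N\<close> lie above a positive lower bound (\<open>finite_admissible_steps\<close>), and one constant
  dominates all of them.
\<close>

section \<open>Calculus of smooth maps\<close>

lemma Ck_SucI:
  assumes "\<And>x. (g has_derivative D x) (at x)" and "\<And>v. Ck k (\<lambda>x. D x v)"
  shows "Ck (Suc k) g"
proof -
  have "frechet_derivative g (at x) = D x" for x
    using frechet_derivative_at[OF assms(1)[of x]] by simp
  then show ?thesis
    using assms by (auto simp: differentiable_def)
qed

lemma Ck_SucD:
  assumes "Ck (Suc k) g"
  shows "(g has_derivative frechet_derivative g (at x)) (at x)"
    and "Ck k (\<lambda>x. frechet_derivative g (at x) v)"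
  using assms frechet_derivative_works by auto

lemma Ck_Suc_imp_Ck: "Ck (Suc k) g \<Longrightarrow> Ck k g"
proof (induction k arbitrary: g)
  case 0
  then show ?case
    by (auto intro!: differentiable_imp_continuous_on simp: differentiable_on_def)
next
  case (Suc k)
  have "Ck k (\<lambda>x. frechet_derivative g (at x) v)" for v
    using Suc.prems by (intro Suc.IH Ck_SucD(2))
  then show ?case
    using Suc.prems by simp
qed

lemma Ck_const: "Ck k (\<lambda>x. c)"
proof (induction k arbitrary: c)
  case (Suc k)
  show ?case
    by (rule Ck_SucI[where D = "\<lambda>x v. 0"]) (use Suc in auto)
qed simp

lemma Ck_bounded_linear:
  assumes "bounded_linear l"
  shows "Ck k l"
proof (cases k)
  case 0
  then show ?thesis
    using assms by (simp add: linear_continuous_on)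
next
  case (Suc j)
  show ?thesis
    unfolding Suc
    by (rule Ck_SucI[where D = "\<lambda>x. l"])
      (use assms in \<open>auto intro: bounded_linear_imp_has_derivative Ck_const\<close>)
qed

lemma Ck_add: "Ck k f \<Longrightarrow> Ck k g \<Longrightarrow> Ck k (\<lambda>x. f x + g x)"
proof (induction k arbitrary: f g)
  case 0
  then show ?case
    by (auto intro: continuous_intros)
next
  case (Suc k)
  show ?case
  proof (rule Ck_SucI)
    show "((\<lambda>x. f x + g x) has_derivative
        (\<lambda>v. frechet_derivative f (at x) v + frechet_derivative g (at x) v)) (at x)" for x
      using Suc.prems by (intro has_derivative_add Ck_SucD(1))
    show "Ck k (\<lambda>x. frechet_derivative f (at x) v + frechet_derivative g (at x) v)" for v
      using Suc.prems by (intro Suc.IH Ck_SucD(2))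
  qed
qed

lemma Ck_sum: "(\<And>i. i \<in> I \<Longrightarrow> Ck k (f i)) \<Longrightarrow> Ck k (\<lambda>x. \<Sum>i\<in>I. f i x)"
  by (induction I rule: infinite_finite_induct) (auto intro: Ck_const Ck_add)

lemma Ck_bilinear:
  fixes prod :: "'u::euclidean_space \<Rightarrow> 'v::euclidean_space \<Rightarrow> 'w::euclidean_space"
    and f :: "'x::euclidean_space \<Rightarrow> 'u" and g :: "'x \<Rightarrow> 'v"
  assumes "bounded_bilinear prod"
  shows "Ck k f \<Longrightarrow> Ck k g \<Longrightarrow> Ck k (\<lambda>x. prod (f x) (g x))"
proof (induction k arbitrary: f g)
  case 0
  then show ?case
    by (auto intro: bounded_bilinear.continuous_on[OF assms])
next
  case (Suc k)
  show ?case
  proof (rule Ck_SucI)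
    show "((\<lambda>x. prod (f x) (g x)) has_derivative
        (\<lambda>v. prod (f x) (frechet_derivative g (at x) v)
          + prod (frechet_derivative f (at x) v) (g x))) (at x)" for x
      using Suc.prems by (intro bounded_bilinear.FDERIV[OF assms] Ck_SucD(1))
    show "Ck k (\<lambda>x. prod (f x) (frechet_derivative g (at x) v)
          + prod (frechet_derivative f (at x) v) (g x))" for v
      using Suc.prems
      by (intro Ck_add Suc.IH Ck_SucD(2)[OF Suc.prems(1)] Ck_SucD(2)[OF Suc.prems(2)]
          Ck_Suc_imp_Ck[OF Suc.prems(1)] Ck_Suc_imp_Ck[OF Suc.prems(2)])
  qed
qed

text \<open>
  The chain rule yields \<open>F'(g x) (g'(x) v)\<close>, where the direction itself depends on \<open>x\<close>. Expanding
  that direction in the basis leaves only derivatives of \<open>F\<close> in fixed directions composed with \<open>g\<close>,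
  to which the induction hypothesis applies.
\<close>
lemma Ck_compose: "Ck k F \<Longrightarrow> Ck k g \<Longrightarrow> Ck k (\<lambda>x. F (g x))"
  for F :: "'b::euclidean_space \<Rightarrow> 'c::euclidean_space" and g :: "'a::euclidean_space \<Rightarrow> 'b"
proof (induction k arbitrary: F)
  case 0
  then show ?case
    by (auto intro: continuous_on_compose2)
next
  case (Suc k)
  let ?F' = "\<lambda>y. frechet_derivative F (at y)" and ?g' = "\<lambda>x. frechet_derivative g (at x)"
  have expand: "?F' (g x) (?g' x v) = (\<Sum>b\<in>Basis. (?g' x v \<bullet> b) *\<^sub>R ?F' (g x) b)" for x v
  proof -
    have "linear (?F' (g x))"
      by (rule has_derivative_linear[OF Ck_SucD(1)[OF Suc.prems(1)]])
    then have "?F' (g x) (\<Sum>b\<in>Basis. (?g' x v \<bullet> b) *\<^sub>R b)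
        = (\<Sum>b\<in>Basis. (?g' x v \<bullet> b) *\<^sub>R ?F' (g x) b)"
      by (simp add: linear_sum linear_scale)
    then show ?thesis
      by (simp only: euclidean_representation)
  qed
  show ?case
  proof (rule Ck_SucI)
    show "((\<lambda>x. F (g x)) has_derivative (\<lambda>v. ?F' (g x) (?g' x v))) (at x)" for x
      by (rule has_derivative_compose[OF Ck_SucD(1)[OF Suc.prems(2)] Ck_SucD(1)[OF Suc.prems(1)]])
    show "Ck k (\<lambda>x. ?F' (g x) (?g' x v))" for v
      unfolding expand
      by (intro Ck_sum Ck_bilinear[OF bounded_bilinear_scaleR]
          Ck_bilinear[OF bounded_bilinear_inner] Ck_const Ck_SucD(2)[OF Suc.prems(2)]
          Suc.IH[OF Ck_SucD(2)[OF Suc.prems(1)] Ck_Suc_imp_Ck[OF Suc.prems(2)]])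
  qed
qed

lemma smooth_const: "smooth (\<lambda>x. c)"
  by (simp add: smooth_def Ck_const)

lemma smooth_add: "smooth f \<Longrightarrow> smooth g \<Longrightarrow> smooth (\<lambda>x. f x + g x)"
  by (simp add: smooth_def Ck_add)

lemma smooth_sum: "(\<And>i. i \<in> I \<Longrightarrow> smooth (f i)) \<Longrightarrow> smooth (\<lambda>x. \<Sum>i\<in>I. f i x)"
  by (simp add: smooth_def Ck_sum)

lemma smooth_compose: "smooth F \<Longrightarrow> smooth g \<Longrightarrow> smooth (\<lambda>x. F (g x))"
  by (simp add: smooth_def Ck_compose)

lemma smooth_bounded_linear: "bounded_linear l \<Longrightarrow> smooth l"
  by (simp add: smooth_def Ck_bounded_linear)

lemma smooth_scaleR_const: "smooth g \<Longrightarrow> smooth (\<lambda>x. c *\<^sub>R g x)"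
  using smooth_compose[OF smooth_bounded_linear[OF bounded_linear_scaleR_right]] .

section \<open>Smoothness of the learned field\<close>

lemma mlp_layers_imp_smooth: "mlp_layers H m \<Longrightarrow> smooth (\<lambda>x. H x i)"
proof (induction arbitrary: i rule: mlp_layers.induct)
  case (input_affine w b m)
  show ?case
    by (rule smooth_add[OF smooth_bounded_linear[OF bounded_linear_inner_right] smooth_const])
next
  case (activation H m \<sigma>)
  then show ?case
    using smooth_compose by blast
next
  case (hidden_affine H m W b m')
  have "smooth (\<lambda>x. W i j * H x j)" for j
    using smooth_scaleR_const[OF hidden_affine.IH[of j], of "W i j"] by simp
  then show ?case
    by (intro smooth_add smooth_const smooth_sum)
qed

lemma smooth_mlp_imp_smooth:
  assumes "smooth_mlp F"
  shows "smooth F"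
proof -
  obtain H m v c where H: "mlp_layers H m" and F: "F = (\<lambda>x. (\<Sum>i<m. H x i *\<^sub>R v i) + c)"
    using assms unfolding smooth_mlp_def by blast
  have "smooth (\<lambda>x. H x i *\<^sub>R v i)" for i
    using smooth_compose[OF smooth_bounded_linear[OF bounded_linear_scaleR_left]
        mlp_layers_imp_smooth[OF H]] .
  then show ?thesis
    unfolding F by (intro smooth_add smooth_const smooth_sum)
qed

lemma smooth_slice:
  fixes R :: "'a::euclidean_space \<times> real \<Rightarrow> 'b::euclidean_space"
  assumes "smooth R"
  shows "smooth (\<lambda>y. R (y, h))"
proof -
  have "bounded_linear (\<lambda>y::'a. (y, 0::real))"
    by (intro bounded_linear_Pair bounded_linear_ident bounded_linear_zero)
  then have "smooth (\<lambda>y::'a. (y, 0) + (0, h))"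
    by (rule smooth_add[OF smooth_bounded_linear smooth_const])
  then have "smooth (\<lambda>y::'a. (y, h))"
    by simp
  with assms show ?thesis
    by (rule smooth_compose)
qed

lemma smooth_perturbed_field:
  assumes "smooth f" "\<And>j. j \<in> {1..K-1} \<Longrightarrow> smooth (g j)" "smooth R"
  shows "smooth (perturbed_field p K f g R h)"
proof -
  have "smooth (\<lambda>y. f y + h ^ p *\<^sub>R (\<Sum>j=1..K-1. h ^ (j - 1) *\<^sub>R g j y)
      + h ^ (K + p - 1) *\<^sub>R R (y, h))"
    using assms by (intro smooth_add smooth_scaleR_const smooth_sum smooth_slice)
  then show ?thesis
    by (simp add: perturbed_field_def[abs_def])
qed

section \<open>Uniqueness of solutions and the semigroup property\<close>

text \<open>
  On a ball the derivative of a \<open>C\<^sup>1\<close> map is bounded: its operator norm is at most the sum of the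
  norms of the partial derivatives, a continuous function on a compact set. The mean value
  inequality turns this into a Lipschitz bound.
\<close>
lemma smooth_lipschitz_on_cball:
  fixes f :: "'a::euclidean_space \<Rightarrow> 'b::euclidean_space"
  assumes "smooth f"
  obtains K where "0 \<le> K"
    "\<And>x y. x \<in> cball 0 r \<Longrightarrow> y \<in> cball 0 r \<Longrightarrow> norm (f x - f y) \<le> K * norm (x - y)"
proof -
  have C1: "Ck (Suc 0) f"
    using assms unfolding smooth_def by blast
  let ?D = "\<lambda>x. frechet_derivative f (at x)"
  let ?s = "\<lambda>x. \<Sum>b\<in>Basis. norm (?D x b)"
  have "continuous_on UNIV (\<lambda>x. ?D x b)" for b
    using Ck_SucD(2)[OF C1] by simp
  then have "continuous_on (cball 0 r) ?s"
    by (intro continuous_on_sum continuous_on_norm) (meson continuous_on_subset subset_UNIV)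
  then have "bounded (?s ` cball 0 r)"
    by (intro compact_imp_bounded compact_continuous_image compact_cball)
  then obtain K where K: "K > 0" "\<And>x. x \<in> cball 0 r \<Longrightarrow> norm (?s x) \<le> K"
    unfolding bounded_pos by blast
  have "norm (f x - f y) \<le> K * norm (x - y)" if "x \<in> cball 0 r" "y \<in> cball 0 r" for x y
  proof (rule differentiable_bound[OF convex_cball _ _ that])
    fix z :: 'a
    assume z: "z \<in> cball 0 r"
    show "(f has_derivative ?D z) (at z within cball 0 r)"
      by (rule has_derivative_at_withinI[OF Ck_SucD(1)[OF C1]])
    have "onorm (?D z) \<le> ?s z"
      by (rule onorm_componentwise[OF has_derivative_bounded_linear[OF Ck_SucD(1)[OF C1]]])
    then show "onorm (?D z) \<le> K"
      using K(2)[OF z] by simp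
  qed
  with K(1) show thesis
    by (intro that[of K]) auto
qed

lemma solves_ivp_continuous_on: "solves_ivp g y T u \<Longrightarrow> continuous_on {0..T} u"
  unfolding solves_ivp_def continuous_on_eq_continuous_within
  by (auto intro: has_vector_derivative_continuous)

text \<open>
  Gronwall's argument: with \<open>K\<close> a Lipschitz constant on a ball containing both trajectories, the
  derivative of \<open>exp (- 2 K s) |u(s) - v(s)|\<^sup>2\<close> is nonpositive. This function vanishes at \<open>0\<close> and is
  nonnegative, so it vanishes throughout.
\<close>
lemma solves_ivp_unique:
  fixes f :: "'a::euclidean_space \<Rightarrow> 'a"
  assumes f: "smooth f" and u: "solves_ivp f y T u" and v: "solves_ivp f y T v"
    and t: "0 \<le> t" "t \<le> T"
  shows "u t = v t"
proof -
  have "bounded (u ` {0..T} \<union> v ` {0..T})"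
    using u v by (intro bounded_Un[THEN iffD2] conjI compact_imp_bounded
        compact_continuous_image solves_ivp_continuous_on) auto
  then obtain r where r: "\<And>x. x \<in> u ` {0..T} \<union> v ` {0..T} \<Longrightarrow> norm x \<le> r"
    unfolding bounded_pos by blast
  obtain K where K: "0 \<le> K"
    "\<And>x y. x \<in> cball 0 r \<Longrightarrow> y \<in> cball 0 r \<Longrightarrow> norm (f x - f y) \<le> K * norm (x - y)"
    using smooth_lipschitz_on_cball[OF f, of r] by blast
  let ?w = "\<lambda>s. u s - v s"
  let ?E = "\<lambda>s. exp (- 2 * K * s) * (?w s \<bullet> ?w s)"
  let ?E' = "\<lambda>s. exp (- 2 * K * s) * (2 * (?w s \<bullet> (f (u s) - f (v s))) - 2 * K * (?w s \<bullet> ?w s))"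
  have deriv: "(?E has_derivative (\<lambda>d. d * ?E' s)) (at s within {0..t})" if "s \<in> {0..t}" for s
  proof -
    have "(u has_vector_derivative f (u s)) (at s within {0..t})"
      "(v has_vector_derivative f (v s)) (at s within {0..t})"
      using u v t that
      by (auto simp: solves_ivp_def
          intro: has_vector_derivative_within_subset[where S = "{0..T}"])
    then have "(u has_derivative (\<lambda>d. d *\<^sub>R f (u s))) (at s within {0..t})"
      "(v has_derivative (\<lambda>d. d *\<^sub>R f (v s))) (at s within {0..t})"
      by (simp_all add: has_vector_derivative_def)
    then show ?thesis
      by (auto intro!: derivative_eq_intros ext
          simp: algebra_simps inner_diff_left inner_diff_right inner_commute)
  qed
  have E'_nonpos: "?E' s \<le> 0" if "s \<in> {0..t}" for s
  proof -
    have "?w s \<bullet> (f (u s) - f (v s)) \<le> norm (?w s) * norm (f (u s) - f (v s))"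
      by (rule norm_cauchy_schwarz)
    also have "\<dots> \<le> norm (?w s) * (K * norm (?w s))"
      using that t r by (intro mult_left_mono K(2)) auto
    also have "\<dots> = K * (?w s \<bullet> ?w s)"
      by (simp add: dot_square_norm power2_eq_square)
    finally show ?thesis
      by (simp add: mult_le_0_iff)
  qed
  have "?E t \<le> ?E 0"
  proof -
    obtain s where "s \<in> {0..t}" "?E t - ?E 0 = t * ?E' s"
      using mvt_very_simple[OF t(1), of ?E "\<lambda>s d. d * ?E' s"] deriv by auto
    moreover have "t * ?E' s \<le> 0"
      using E'_nonpos[OF \<open>s \<in> {0..t}\<close>] t(1) by (rule mult_nonneg_nonpos[rotated])
    ultimately show ?thesis
      by linarith
  qed
  also have "?E 0 = 0"
    using u v by (simp add: solves_ivp_def)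
  finally have "?w t \<bullet> ?w t \<le> 0"
    by (simp add: mult_le_0_iff)
  then have "?w t \<bullet> ?w t = 0"
    by (intro antisym inner_ge_zero)
  then show ?thesis
    by simp
qed

lemma solves_ivp_restrict:
  "solves_ivp f y T u \<Longrightarrow> t \<le> T \<Longrightarrow> solves_ivp f y t u"
  by (auto simp: solves_ivp_def intro: has_vector_derivative_within_subset[where S = "{0..T}"])

lemma solves_ivp_shift:
  assumes u: "solves_ivp f y T u" and s: "0 \<le> s" "s + t \<le> T"
  shows "solves_ivp f (u s) t (\<lambda>\<tau>. u (s + \<tau>))"
  unfolding solves_ivp_def
proof (intro conjI ballI)
  fix \<tau>
  assume \<tau>: "\<tau> \<in> {0..t}"
  have "(u has_vector_derivative f (u (s + \<tau>))) (at (s + \<tau>) within {0..T})"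
    using u s \<tau> by (auto simp: solves_ivp_def)
  moreover have "((+) s) ` {0..t} \<subseteq> {0..T}"
    using s by auto
  ultimately have "(u has_vector_derivative f (u (s + \<tau>))) (at (s + \<tau>) within ((+) s) ` {0..t})"
    by (rule has_vector_derivative_within_subset)
  moreover have "((\<lambda>\<tau>. s + \<tau>) has_vector_derivative 1) (at \<tau> within {0..t})"
    by (auto intro!: derivative_eq_intros)
  ultimately show "((\<lambda>\<tau>. u (s + \<tau>)) has_vector_derivative f (u (s + \<tau>))) (at \<tau> within {0..t})"
    using vector_diff_chain_within[of "(+) s" 1 \<tau> "{0..t}" u "f (u (s + \<tau>))"]
    by (simp add: o_def)
qed simp

lemma exact_flow_eq:
  assumes f: "smooth f" and u: "solves_ivp f y T u" and t: "0 \<le> t" "t \<le> T"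
  shows "exact_flow f t y = u t"
  unfolding exact_flow_def
proof (rule the_equality)
  show "\<exists>w. solves_ivp f y t w \<and> w t = u t"
    using solves_ivp_restrict[OF u t(2)] by blast
  show "z = u t" if "\<exists>w. solves_ivp f y t w \<and> w t = z" for z
    using that solves_ivp_unique[OF f _ solves_ivp_restrict[OF u t(2)] t(1) order_refl] by blast
qed

lemma exact_flow_semigroup:
  assumes f: "smooth f" and u: "solves_ivp f y T u" and "0 \<le> s" "0 \<le> t" "s + t \<le> T"
  shows "exact_flow f t (exact_flow f s y) = exact_flow f (s + t) y"
proof -
  have "exact_flow f t (u s) = u (s + t)"
    using assms by (intro exact_flow_eq[OF f solves_ivp_shift[OF u]]) auto
  then show ?thesis
    using assms by (simp add: exact_flow_eq[OF f u])
qed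

lemma exact_flow_iterate:
  assumes f: "smooth f" and u: "solves_ivp f y T u" and h: "0 \<le> h"
  shows "real n * h \<le> T \<Longrightarrow> (exact_flow f h ^^ n) y = exact_flow f (real n * h) y"
proof (induction n)
  case 0
  then show ?case
    using exact_flow_eq[OF f u, of 0] u by (simp add: solves_ivp_def)
next
  case (Suc n)
  have *: "real n * h + h \<le> T"
    using Suc.prems by (simp add: algebra_simps)
  then show ?case
    using Suc.IH h exact_flow_semigroup[OF f u _ h *] by (simp add: algebra_simps)
qed

section \<open>Accumulation of the local errors\<close>

lemma is_norm_nonneg:
  assumes "is_norm nrm"
  shows "0 \<le> nrm x"
proof -
  have "nrm (x + (-1) *\<^sub>R x) \<le> nrm x + nrm ((-1) *\<^sub>R x)" "nrm ((-1) *\<^sub>R x) = \<bar>-1\<bar> * nrm x" "nrm 0 = 0"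
    using assms unfolding is_norm_def by blast+
  then show ?thesis
    by simp
qed

lemma is_norm_minus_commute:
  assumes "is_norm nrm"
  shows "nrm (x - y) = nrm (y - x)"
proof -
  have "nrm ((-1) *\<^sub>R (x - y)) = \<bar>-1\<bar> * nrm (x - y)"
    using assms unfolding is_norm_def by blast
  then show ?thesis
    by simp
qed

lemma is_norm_triangle_diff:
  assumes "is_norm nrm"
  shows "nrm (x - z) \<le> nrm (x - y) + nrm (y - z)"
proof -
  have "nrm ((x - y) + (y - z)) \<le> nrm (x - y) + nrm (y - z)"
    using assms unfolding is_norm_def by blast
  then show ?thesis
    by simp
qed

text \<open>
  The supremum norm takes extended values and may be infinite. A pointwise bound on \<open>G\<close> makes the
  right-hand side of a stability estimate finite, so that the estimate can be read off in the reals
  at each point.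
\<close>
lemma Linf_norm_bound_transfer:
  assumes stab: "Linf_norm nrm \<Omega> F \<le> ennreal c * Linf_norm nrm \<Omega> G"
    and c: "0 \<le> c" and B: "0 \<le> B" "\<And>y. y \<in> \<Omega> \<Longrightarrow> nrm (G y) \<le> B" and x: "x \<in> \<Omega>"
  shows "nrm (F x) \<le> c * B"
proof -
  have "ennreal (nrm (F x)) \<le> Linf_norm nrm \<Omega> F"
    unfolding Linf_norm_def using x by (intro SUP_upper)
  also have "\<dots> \<le> ennreal c * Linf_norm nrm \<Omega> G"
    by (rule stab)
  also have "\<dots> \<le> ennreal c * ennreal B"
    unfolding Linf_norm_def using B by (intro mult_left_mono SUP_least ennreal_leI) auto
  also have "\<dots> = ennreal (c * B)"
    using c B by (simp add: ennreal_mult)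
  finally show ?thesis
    using c B by (simp add: ennreal_le_iff)
qed

text \<open>
  Summing the geometric series gives \<open>e\<^sub>n \<le> (b / L) ((1 + L h)\<^sup>n - 1)\<close>, and \<open>1 + L h \<le> exp (L h)\<close>.
  The defect is written \<open>h b\<close>, so that the step cancels in the sum of the series.
\<close>
lemma discrete_gronwall:
  fixes e :: "nat \<Rightarrow> real"
  assumes "0 < L" "0 \<le> h" "0 \<le> b" "e 0 \<le> 0"
    and step: "\<And>n. n < N \<Longrightarrow> e (Suc n) \<le> (1 + L * h) * e n + h * b"
    and "n \<le> N"
  shows "e n \<le> b / L * (exp (L * (real n * h)) - 1)"
proof -
  have "e n \<le> b / L * ((1 + L * h) ^ n - 1)"
    using \<open>n \<le> N\<close>
  proof (induction n)
    case 0
    then show ?case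
      using \<open>e 0 \<le> 0\<close> by simp
  next
    case (Suc n)
    have "e (Suc n) \<le> (1 + L * h) * e n + h * b"
      using Suc.prems by (intro step) simp
    also have "\<dots> \<le> (1 + L * h) * (b / L * ((1 + L * h) ^ n - 1)) + h * b"
      using Suc assms by (intro add_right_mono mult_left_mono) auto
    also have "\<dots> = b / L * ((1 + L * h) ^ Suc n - 1)"
      using \<open>0 < L\<close> by (simp add: field_simps)
    finally show ?case .
  qed
  also have "\<dots> \<le> b / L * (exp (L * h) ^ n - 1)"
    using assms by (intro mult_left_mono diff_right_mono power_mono exp_ge_add_one_self) auto
  also have "exp (L * h) ^ n = exp (L * (real n * h))"
    by (simp add: exp_of_nat_mult[symmetric] algebra_simps)
  finally show ?thesis .
qed

lemma finite_admissible_steps: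
  fixes T a b :: real
  assumes "0 < a"
  shows "finite {h. \<exists>N\<ge>1. h = T / real N \<and> h \<in> {a..b}}"
proof (rule finite_subset)
  show "{h. \<exists>N\<ge>1. h = T / real N \<and> h \<in> {a..b}} \<subseteq> (\<lambda>N. T / real N) ` {..nat \<lceil>T / a\<rceil>}"
  proof clarify
    fix N :: nat
    assume N: "1 \<le> N" "T / real N \<in> {a..b}"
    then have "real N \<le> T / a"
      using assms by (simp add: field_simps)
    then have "N \<le> nat \<lceil>T / a\<rceil>"
      by linarith
    then show "T / real N \<in> (\<lambda>N. T / real N) ` {..nat \<lceil>T / a\<rceil>}"
      by blast
  qed
qed simp

theorem theorem1:
  fixes nrm :: "real ^ 'd \<Rightarrow> real"
    and f :: "real ^ 'd \<Rightarrow> real ^ 'd"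
    and y0 :: "real ^ 'd"
    and \<Omega> :: "(real ^ 'd) set"
    and T h_min h_max C \<delta> :: real
    and p k N\<^sub>t :: nat
    and \<Phi> :: "(real ^ 'd) one_step_method"
    and f_mod f_learn :: "nat \<Rightarrow> real ^ 'd \<Rightarrow> real ^ 'd"
    and R R\<^sub>a :: "(real ^ 'd) \<times> real \<Rightarrow> real ^ 'd"
    and f_tilde f_app :: "real \<Rightarrow> real ^ 'd \<Rightarrow> real ^ 'd"
  assumes norm: "is_norm nrm"
    and f_smooth: "smooth f"
    and T_pos: "0 < T"
    and h_bounds: "0 < h_min" "h_min < h_max"
    and solution_exists: "\<exists>u. solves_ivp f y0 T u"
    and p_ge: "1 \<le> p"
    and order: "has_order nrm \<Phi> f y0 T h_max p"
    and k_ge: "1 \<le> k"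
    and f_tilde_form: "\<And>h y. h \<in> {h_min..h_max} \<Longrightarrow>
          f_tilde h y = perturbed_field p k f f_mod R h y"
    and f_tilde_smooth: "\<And>h. h \<in> {h_min..h_max} \<Longrightarrow> smooth (f_tilde h)"
    and f_tilde_exact: "\<And>N h n. 1 \<le> N \<Longrightarrow> h = T / real N \<Longrightarrow> h \<in> {h_min..h_max} \<Longrightarrow> n < N \<Longrightarrow>
          \<Phi> h (f_tilde h) (exact_flow f (real n * h) y0) = exact_flow f h (exact_flow f (real n * h) y0)"
    and Nt_ge: "1 \<le> N\<^sub>t"
    and f_learn_mlp: "\<And>j. j \<in> {1..N\<^sub>t-1} \<Longrightarrow> smooth_mlp (f_learn j)"
    and R\<^sub>a_mlp: "smooth_mlp R\<^sub>a"
    and f_app_form: "\<And>h y. h \<in> {h_min..h_max} \<Longrightarrow>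
          f_app h y = perturbed_field p N\<^sub>t f f_learn R\<^sub>a h y"
    and \<Omega>_compact: "compact \<Omega>"
    and y0_in: "y0 \<in> \<Omega>"
    and exact_in: "\<And>N h n. 1 \<le> N \<Longrightarrow> h = T / real N \<Longrightarrow> h \<in> {h_min..h_max} \<Longrightarrow> n \<le> N \<Longrightarrow>
          exact_flow f (real n * h) y0 \<in> \<Omega>"
    and numerical_in: "\<And>N h n. 1 \<le> N \<Longrightarrow> h = T / real N \<Longrightarrow> h \<in> {h_min..h_max} \<Longrightarrow> n \<le> N \<Longrightarrow>
          (\<Phi> h (f_app h) ^^ n) y0 \<in> \<Omega>"
    and learning_error: "is_max \<delta>
          {nrm (f_tilde h y - f_app h y) / h ^ p | y h. (y, h) \<in> \<Omega> \<times> {h_min..h_max}}"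
    and C_pos: "0 < C"
    and field_stability: "\<And>f\<^sub>1 f\<^sub>2 h. smooth f\<^sub>1 \<Longrightarrow> smooth f\<^sub>2 \<Longrightarrow> 0 \<le> h \<Longrightarrow> h \<le> h_max \<Longrightarrow>
          Linf_norm nrm \<Omega> (\<lambda>y. \<Phi> h f\<^sub>1 y - \<Phi> h f\<^sub>2 y)
            \<le> ennreal (C * h) * Linf_norm nrm \<Omega> (\<lambda>y. f\<^sub>1 y - f\<^sub>2 y)"
    and flow_stability: "\<And>g. smooth g \<Longrightarrow> \<exists>L>0. \<forall>h. 0 \<le> h \<and> h \<le> h_max \<longrightarrow>
          (\<forall>y\<^sub>1\<in>\<Omega>. \<forall>y\<^sub>2\<in>\<Omega>. nrm (\<Phi> h g y\<^sub>1 - \<Phi> h g y\<^sub>2) \<le> (1 + L * h) * nrm (y\<^sub>1 - y\<^sub>2))"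
  shows "\<exists>L>0. \<forall>N\<ge>1. \<forall>h. h = T / real N \<and> h \<in> {h_min..h_max} \<longrightarrow>
          Max ((\<lambda>n. nrm ((\<Phi> h (f_app h) ^^ n) y0 - (exact_flow f h ^^ n) y0)) ` {0..N})
            \<le> C * \<delta> * h ^ p / L * (exp (L * T) - 1)"
proof -
  obtain u where u: "solves_ivp f y0 T u"
    using solution_exists by blast
  have app_smooth: "smooth (f_app h)" if h: "h \<in> {h_min..h_max}" for h
  proof -
    have "smooth (perturbed_field p N\<^sub>t f f_learn R\<^sub>a h)"
      by (rule smooth_perturbed_field[OF f_smooth smooth_mlp_imp_smooth[OF f_learn_mlp]
            smooth_mlp_imp_smooth[OF R\<^sub>a_mlp]])
    moreover have "f_app h = perturbed_field p N\<^sub>t f f_learn R\<^sub>a h"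
      using f_app_form[OF h] by (rule ext)
    ultimately show ?thesis
      by simp
  qed
  have defect: "nrm (f_app h y - f_tilde h y) \<le> \<delta> * h ^ p" if "h \<in> {h_min..h_max}" "y \<in> \<Omega>" for h y
  proof -
    have "nrm (f_tilde h y - f_app h y) / h ^ p \<le> \<delta>"
      using learning_error that unfolding is_max_def by blast
    moreover have "0 < h ^ p"
      using that h_bounds by simp
    ultimately show ?thesis
      by (simp add: pos_divide_le_eq is_norm_minus_commute[OF norm, of "f_app h y"])
  qed
  have \<delta>_nonneg: "0 \<le> \<delta>"
  proof -
    obtain y h where "h \<in> {h_min..h_max}" "\<delta> = nrm (f_tilde h y - f_app h y) / h ^ p"
      using learning_error unfolding is_max_def by blast
    then show ?thesis
      using h_bounds is_norm_nonneg[OF norm] by simp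
  qed

  define S where "S = {h. \<exists>N\<ge>1. h = T / real N \<and> h \<in> {h_min..h_max}}"
  have fin: "finite S"
    unfolding S_def using h_bounds(1) by (rule finite_admissible_steps)
  have "\<forall>h\<in>S. \<exists>L>0. \<forall>y\<^sub>1\<in>\<Omega>. \<forall>y\<^sub>2\<in>\<Omega>.
      nrm (\<Phi> h (f_app h) y\<^sub>1 - \<Phi> h (f_app h) y\<^sub>2) \<le> (1 + L * h) * nrm (y\<^sub>1 - y\<^sub>2)"
  proof
    fix h
    assume "h \<in> S"
    then have h: "h \<in> {h_min..h_max}"
      by (auto simp: S_def)
    show "\<exists>L>0. \<forall>y\<^sub>1\<in>\<Omega>. \<forall>y\<^sub>2\<in>\<Omega>.
        nrm (\<Phi> h (f_app h) y\<^sub>1 - \<Phi> h (f_app h) y\<^sub>2) \<le> (1 + L * h) * nrm (y\<^sub>1 - y\<^sub>2)"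
      using flow_stability[OF app_smooth[OF h]] h h_bounds by fastforce
  qed
  then obtain \<Lambda> where \<Lambda>: "\<And>h. h \<in> S \<Longrightarrow> 0 < \<Lambda> h"
    "\<And>h y\<^sub>1 y\<^sub>2. h \<in> S \<Longrightarrow> y\<^sub>1 \<in> \<Omega> \<Longrightarrow> y\<^sub>2 \<in> \<Omega> \<Longrightarrow>
      nrm (\<Phi> h (f_app h) y\<^sub>1 - \<Phi> h (f_app h) y\<^sub>2) \<le> (1 + \<Lambda> h * h) * nrm (y\<^sub>1 - y\<^sub>2)"
    by metis
  \<comment> \<open>The sum dominates every \<open>\<Lambda> h\<close>; the summand 1 keeps \<open>L\<close> positive when no step is admissible.\<close>
  define L where "L = 1 + sum \<Lambda> S"
  have L_pos: "0 < L"
    unfolding L_def using sum_nonneg[of S \<Lambda>] \<Lambda>(1) by (force intro: add_pos_nonneg less_imp_le)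
  have \<Lambda>_le: "\<Lambda> h \<le> L" if "h \<in> S" for h
  proof -
    have "\<Lambda> h \<le> sum \<Lambda> S"
      using that fin \<Lambda>(1) by (intro member_le_sum) (auto intro: less_imp_le)
    then show ?thesis
      by (simp add: L_def)
  qed

  have "nrm ((\<Phi> h (f_app h) ^^ n) y0 - (exact_flow f h ^^ n) y0)
      \<le> C * \<delta> * h ^ p / L * (exp (L * T) - 1)"
    if N: "1 \<le> N" and hN: "h = T / real N" and h: "h \<in> {h_min..h_max}" and n: "n \<le> N" for N h n
  proof -
    have hS: "h \<in> S"
      using N hN h by (auto simp: S_def)
    have h_pos: "0 < h"
      using h h_bounds by simp
    have time: "real n * h \<le> T" if "n \<le> N" for n
    proof -
      have "real n * h \<le> real N * h"
        using that h_pos by (intro mult_right_mono) auto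
      then show ?thesis
        using N by (simp add: hN)
    qed
    let ?x = "\<lambda>n. (\<Phi> h (f_app h) ^^ n) y0" and ?y = "\<lambda>n. (exact_flow f h ^^ n) y0"
    have y_eq: "?y n = exact_flow f (real n * h) y0" if "n \<le> N" for n
      using exact_flow_iterate[OF f_smooth u less_imp_le[OF h_pos] time[OF that]] .
    have "nrm (?x n - ?y n) \<le> C * (\<delta> * h ^ p) / L * (exp (L * (real n * h)) - 1)"
    proof (rule discrete_gronwall[where e = "\<lambda>n. nrm (?x n - ?y n)", OF L_pos _ _ _ _ n])
      show "0 \<le> h" "0 \<le> C * (\<delta> * h ^ p)"
        using h_pos C_pos \<delta>_nonneg by auto
      have "nrm 0 = 0"
        using norm by (simp add: is_norm_def)
      then show "nrm (?x 0 - ?y 0) \<le> 0"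
        by simp
      fix m
      assume m: "m < N"
      have x_in: "?x m \<in> \<Omega>" and y_in: "?y m \<in> \<Omega>"
        using numerical_in[OF N hN h] exact_in[OF N hN h] y_eq m by auto
      have "?y (Suc m) = \<Phi> h (f_tilde h) (?y m)"
        using f_tilde_exact[OF N hN h m] y_eq[of m] m by simp
      then have "nrm (?x (Suc m) - ?y (Suc m))
          \<le> nrm (\<Phi> h (f_app h) (?x m) - \<Phi> h (f_app h) (?y m))
            + nrm (\<Phi> h (f_app h) (?y m) - \<Phi> h (f_tilde h) (?y m))"
        using is_norm_triangle_diff[OF norm] by simp
      also have "\<dots> \<le> (1 + L * h) * nrm (?x m - ?y m) + C * h * (\<delta> * h ^ p)"
      proof (rule add_mono)
        have "nrm (\<Phi> h (f_app h) (?x m) - \<Phi> h (f_app h) (?y m))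
            \<le> (1 + \<Lambda> h * h) * nrm (?x m - ?y m)"
          by (rule \<Lambda>(2)[OF hS x_in y_in])
        also have "\<dots> \<le> (1 + L * h) * nrm (?x m - ?y m)"
          using \<Lambda>_le[OF hS] h_pos
          by (intro mult_right_mono add_left_mono is_norm_nonneg[OF norm]) auto
        finally show "nrm (\<Phi> h (f_app h) (?x m) - \<Phi> h (f_app h) (?y m))
            \<le> (1 + L * h) * nrm (?x m - ?y m)" .
        show "nrm (\<Phi> h (f_app h) (?y m) - \<Phi> h (f_tilde h) (?y m)) \<le> C * h * (\<delta> * h ^ p)"
          using h h_pos C_pos \<delta>_nonneg y_in defect[OF h]
            field_stability[OF app_smooth[OF h] f_tilde_smooth[OF h], of h]
          by (intro Linf_norm_bound_transfer[where \<Omega> = \<Omega> and nrm = nrm]) auto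
      qed
      finally show "nrm (?x (Suc m) - ?y (Suc m))
          \<le> (1 + L * h) * nrm (?x m - ?y m) + h * (C * (\<delta> * h ^ p))"
        by (simp add: algebra_simps)
    qed
    also have "\<dots> \<le> C * (\<delta> * h ^ p) / L * (exp (L * T) - 1)"
      using time[OF n] L_pos C_pos \<delta>_nonneg h_pos by (intro mult_left_mono) auto
    finally show ?thesis
      by (simp add: mult.assoc)
  qed
  then show ?thesis
    using L_pos by (intro exI[of _ L] conjI allI impI Max.boundedI) auto
qed

end
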